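(* The virtual braid group $VB_n$ on $n$ strands ($n$ any positive integer) is isomorphic to the group of morphisms from $[n]$ to $[n]$ in the String Category $SC$.
   Context: The virtual braid group $VB_n$ is the group with generators $\sigma_1,\dots,\sigma_{n-1},v_1,\dots,v_{n-1}$ and relations (for all indices for which they make sense): (B1) $\sigma_i\sigma_{i+1}\sigma_i=\sigma_{i+1}\sigma_i\sigma_{i+1}$; (B2) $\sigma_i\sigma_j=\sigma_j\sigma_i$ for $|i-j|>1$; (S1) $v_iv_{i+1}v_i=v_{i+1}v_iv_{i+1}$; (S2) $v_iv_j=v_jv_i$ for $|i-j|>1$; (S3) $v_i^2=1$; (M1) $v_i\sigma_{i+1}v_i=v_{i+1}\sigma_iv_{i+1}$; (M2) $\sigma_iv_j=v_j\sigma_i$ for $|i-j|>1$. The String Category $SC$: consider the strict monoidal category freely generated by one object $*$ and three morphisms $\mu,\mu',v:*\otimes*\to*\otimes*$. Its objects are $[n]=*\otimes*\otimes\cdots\otimes*$ ($n$ factors), for each natural number $n$. For an arbitrary number of tensor factors write $v_i=\mathrm{id}_*\otimes\cdots\otimes\mathrm{id}_*\otimes v\otimes\mathrm{id}_*\otimes\cdots\otimes\mathrm{id}_*$ with $v$ occurring in the $i$-th place (acting on factors $i,i+1$), $\mu_{12}=\mu\otimes\mathrm{id}_*\otimes\cdots\otimes\mathrm{id}_*$, and $\mu_{21}=\mu'\otimes\mathrm{id}_*\otimes\cdots\otimes\mathrm{id}_*$. Juxtaposition denotes composition. $SC$ is the quotient of this category (again a strict monoidal category) by the relations (for all indices for which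 they make sense): (1) $\mu\mu'=\mathrm{id}_{*\otimes*}=\mu'\mu$; (2) $vv=\mathrm{id}_{*\otimes*}$; (3) $\mu_{12}v_j=v_j\mu_{12}$ for $j>2$; (4) $\mu_{12}\,v_2\mu_{12}v_2\,v_1v_2\mu_{12}v_2v_1=v_1v_2\mu_{12}v_2v_1\,v_2\mu_{12}v_2\,\mu_{12}$; (5) $\mu_{12}\,v_2v_3v_1v_2\mu_{12}v_2v_1v_3v_2=v_2v_3v_1v_2\mu_{12}v_2v_1v_3v_2\,\mu_{12}$; (6) $v_iv_{i+1}v_i=v_{i+1}v_iv_{i+1}$; (7) $v_iv_j=v_jv_i$ for $j\neq i\pm1$. The morphisms $[n]\to[n]$ in $SC$ form a group under composition.
   Formalization: The relation id⊗μ = v_1v_2μ_12v_2v_1 on three strands is added to (1)–(7) in SC; without it the claim fails for n = 3, since the morphisms [3]→[3] map onto Z^2 (exponents of μ⊗id and id⊗μ) but VB_3 does not. *)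

theory Defs
  imports "HOL-Algebra.Group"
begin

section \<open>Groups given by generators and relations\<close>

text \<open>A letter \<open>(g, True)\<close> stands for the generator \<open>g\<close>, a letter \<open>(g, False)\<close> for its formal
  inverse.\<close>

type_synonym 'g word = "('g \<times> bool) list"

definition words :: "'g set \<Rightarrow> 'g word set" where
  "words S = lists (S \<times> UNIV)"

inductive_set pres_cong :: "'g set \<Rightarrow> ('g word \<times> 'g word) set \<Rightarrow> ('g word \<times> 'g word) set"
  for S :: "'g set" and R :: "('g word \<times> 'g word) set" where
  pres_rel: "(u, w) \<in> R \<Longrightarrow> u \<in> words S \<Longrightarrow> w \<in> words S \<Longrightarrow> (u, w) \<in> pres_cong S R"
| pres_cancel: "g \<in> S \<Longrightarrow> ([(g, b), (g, \<not> b)], []) \<in> pres_cong S R"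
| pres_refl: "u \<in> words S \<Longrightarrow> (u, u) \<in> pres_cong S R"
| pres_sym: "(u, w) \<in> pres_cong S R \<Longrightarrow> (w, u) \<in> pres_cong S R"
| pres_trans: "(u, w) \<in> pres_cong S R \<Longrightarrow> (w, x) \<in> pres_cong S R \<Longrightarrow> (u, x) \<in> pres_cong S R"
| pres_append: "(u, u') \<in> pres_cong S R \<Longrightarrow> (w, w') \<in> pres_cong S R
    \<Longrightarrow> (u @ w, u' @ w') \<in> pres_cong S R"

definition presented_group :: "'g set \<Rightarrow> ('g word \<times> 'g word) set \<Rightarrow> 'g word set monoid" where
  "presented_group S R =
    \<lparr>carrier = words S // pres_cong S R,
     mult = (\<lambda>A B. \<Union>u\<in>A. \<Union>w\<in>B. pres_cong S R `` {u @ w}),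
     one = pres_cong S R `` {[]}\<rparr>"

lemma words_simps [simp]:
  "[] \<in> words S" "x # u \<in> words S \<longleftrightarrow> fst x \<in> S \<and> u \<in> words S"
  "u @ w \<in> words S \<longleftrightarrow> u \<in> words S \<and> w \<in> words S"
  by (cases x; auto simp: words_def)+

lemma pres_cong_words: "(u, w) \<in> pres_cong S R \<Longrightarrow> u \<in> words S \<and> w \<in> words S"
  by (induction rule: pres_cong.induct) auto

lemma equiv_pres_cong: "equiv (words S) (pres_cong S R)"
  by (rule equivI) (auto simp: refl_on_def sym_def trans_def
      intro: pres_cong.intros dest: pres_cong_words)

lemma presented_mult_class:
  assumes "u \<in> words S" "w \<in> words S"
  shows "mult (presented_group S R) (pres_cong S R `` {u}) (pres_cong S R `` {w})
    = pres_cong S R `` {u @ w}"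
proof -
  have "congruent2 (pres_cong S R) (pres_cong S R) (\<lambda>u w. pres_cong S R `` {u @ w})"
    by (rule congruent2I')
      (metis equiv_class_eq[OF equiv_pres_cong] pres_append)
  from UN_equiv_class2[OF equiv_pres_cong equiv_pres_cong this assms]
  show ?thesis by (simp add: presented_group_def)
qed

lemma pres_cong_inverse_word:
  assumes "u \<in> words S"
  shows "\<exists>w\<in>words S. (w @ u, []) \<in> pres_cong S R"
  using assms
proof (induction u)
  case Nil
  then show ?case by (auto intro!: bexI[of _ "[]"] pres_refl)
next
  case (Cons x u)
  obtain g b where x: "x = (g, b)" by (cases x)
  from Cons have gS: "g \<in> S" and u: "u \<in> words S" by (auto simp: x)
  from Cons.IH[OF u] obtain w where w: "w \<in> words S" "(w @ u, []) \<in> pres_cong S R" by blast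
  have "([(g, \<not> b), (g, b)] @ u, [] @ u) \<in> pres_cong S R"
    using pres_cancel[OF gS, of "\<not> b" R] pres_append pres_refl[OF u] by fastforce
  from pres_append[OF pres_refl[OF w(1)] this]
  have "(w @ [(g, \<not> b), (g, b)] @ u, w @ u) \<in> pres_cong S R" by simp
  from pres_trans[OF this w(2)] w(1) gS show ?case
    by (intro bexI[of _ "w @ [(g, \<not> b)]"]) (auto simp: x)
qed

lemma group_presented_group: "group (presented_group S R)"
proof (rule groupI)
  note pm = presented_mult_class
  have car: "A \<in> carrier (presented_group S R) \<longleftrightarrow> (\<exists>u\<in>words S. A = pres_cong S R `` {u})" for A
    by (auto simp: presented_group_def quotient_def)
  have one: "one (presented_group S R) = pres_cong S R `` {[]}"
    by (simp add: presented_group_def)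
  show "mult (presented_group S R) A B \<in> carrier (presented_group S R)"
    if "A \<in> carrier (presented_group S R)" "B \<in> carrier (presented_group S R)" for A B
    using that unfolding car by (metis pm words_simps(3))
  show "one (presented_group S R) \<in> carrier (presented_group S R)"
    unfolding car one by (auto intro!: bexI[of _ "[]"])
  show "mult (presented_group S R) (mult (presented_group S R) A B) C
      = mult (presented_group S R) A (mult (presented_group S R) B C)"
    if "A \<in> carrier (presented_group S R)" "B \<in> carrier (presented_group S R)"
      "C \<in> carrier (presented_group S R)" for A B C
    using that unfolding car by (auto simp: pm)
  show "mult (presented_group S R) (one (presented_group S R)) A = A"
    if "A \<in> carrier (presented_group S R)" for A
    using that unfolding car one by (auto simp: pm)
  show "\<exists>B\<in>carrier (presented_group S R).
      mult (presented_group S R) B A = one (presented_group S R)"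
    if A: "A \<in> carrier (presented_group S R)" for A
  proof -
    from A obtain u where u: "u \<in> words S" "A = pres_cong S R `` {u}" unfolding car by blast
    from pres_cong_inverse_word[OF u(1)] obtain w
      where w: "w \<in> words S" "(w @ u, []) \<in> pres_cong S R" by blast
    show ?thesis
    proof (rule bexI)
      show "mult (presented_group S R) (pres_cong S R `` {w}) A = one (presented_group S R)"
        using u w equiv_class_eq[OF equiv_pres_cong w(2)] by (simp add: pm one)
      show "pres_cong S R `` {w} \<in> carrier (presented_group S R)"
        using w unfolding car by blast
    qed
  qed
qed


section \<open>The virtual braid group\<close>

datatype vb_gen = Sigma_gen nat | V_gen nat

abbreviation sg :: "nat \<Rightarrow> vb_gen \<times> bool" where "sg i \<equiv> (Sigma_gen i, True)"
abbreviation vg :: "nat \<Rightarrow> vb_gen \<times> bool" where "vg i \<equiv> (V_gen i, True)"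

definition vb_gens :: "nat \<Rightarrow> vb_gen set" where
  "vb_gens n = Sigma_gen ` {1..<n} \<union> V_gen ` {1..<n}"

inductive_set vb_rels :: "nat \<Rightarrow> (vb_gen word \<times> vb_gen word) set" for n :: nat where
  B1: "1 \<le> i \<Longrightarrow> i + 1 < n \<Longrightarrow>
    ([sg i, sg (i + 1), sg i], [sg (i + 1), sg i, sg (i + 1)]) \<in> vb_rels n"
| B2: "i \<in> {1..<n} \<Longrightarrow> j \<in> {1..<n} \<Longrightarrow> \<bar>int i - int j\<bar> > 1 \<Longrightarrow>
    ([sg i, sg j], [sg j, sg i]) \<in> vb_rels n"
| S1: "1 \<le> i \<Longrightarrow> i + 1 < n \<Longrightarrow>
    ([vg i, vg (i + 1), vg i], [vg (i + 1), vg i, vg (i + 1)]) \<in> vb_rels n"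
| S2: "i \<in> {1..<n} \<Longrightarrow> j \<in> {1..<n} \<Longrightarrow> \<bar>int i - int j\<bar> > 1 \<Longrightarrow>
    ([vg i, vg j], [vg j, vg i]) \<in> vb_rels n"
| S3: "i \<in> {1..<n} \<Longrightarrow> ([vg i, vg i], []) \<in> vb_rels n"
| M1: "1 \<le> i \<Longrightarrow> i + 1 < n \<Longrightarrow>
    ([vg i, sg (i + 1), vg i], [vg (i + 1), sg i, vg (i + 1)]) \<in> vb_rels n"
| M2: "i \<in> {1..<n} \<Longrightarrow> j \<in> {1..<n} \<Longrightarrow> \<bar>int i - int j\<bar> > 1 \<Longrightarrow>
    ([sg i, vg j], [vg j, sg i]) \<in> vb_rels n"

definition virtual_braid_group :: "nat \<Rightarrow> vb_gen word set monoid" where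
  "virtual_braid_group n = presented_group (vb_gens n) (vb_rels n)"

lemma group_virtual_braid_group: "group (virtual_braid_group n)"
  unfolding virtual_braid_group_def by (rule group_presented_group)


section \<open>The free strict monoidal category and its quotients\<close>

text \<open>Since there is a single generating object, the monoid of objects is \<open>(\<nat>, +, 0)\<close>, the
  natural number \<open>n\<close> standing for the \<open>n\<close>-fold tensor power of the generator.
  In \<open>g \<cdot> f\<close> the morphism \<open>f\<close> is applied first.\<close>

datatype sc_term =
    Ident nat
  | Mu
  | Mu'
  | V
  | Comp sc_term sc_term (infixr \<open>\<cdot>\<close> 65)
  | Tensor sc_term sc_term (infixr \<open>\<otimes>\<^sub>t\<close> 70)

inductive arr :: "sc_term \<Rightarrow> nat \<Rightarrow> nat \<Rightarrow> bool" where
  arr_Ident: "arr (Ident n) n n"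
| arr_Mu: "arr Mu 2 2"
| arr_Mu': "arr Mu' 2 2"
| arr_V: "arr V 2 2"
| arr_Comp: "arr f k m \<Longrightarrow> arr g m n \<Longrightarrow> arr (g \<cdot> f) k n"
| arr_Tensor: "arr f m n \<Longrightarrow> arr g m' n' \<Longrightarrow> arr (f \<otimes>\<^sub>t g) (m + m') (n + n')"

text \<open>\<open>mor_eq R m n\<close> is equality of morphisms from \<open>m\<close> to \<open>n\<close> in the quotient of the free strict
  monoidal category by \<open>R\<close>, where \<open>R N f g\<close> imposes \<open>f = g\<close> among the endomorphisms of \<open>N\<close>: the
  least congruence for composition and tensor product that contains \<open>R\<close> and the axioms of
  a strict monoidal category.\<close>

inductive mor_eq ::
  "(nat \<Rightarrow> sc_term \<Rightarrow> sc_term \<Rightarrow> bool) \<Rightarrow> nat \<Rightarrow> nat \<Rightarrow> sc_term \<Rightarrow> sc_term \<Rightarrow> bool"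
  for R :: "nat \<Rightarrow> sc_term \<Rightarrow> sc_term \<Rightarrow> bool" where
  eq_rel: "R N f g \<Longrightarrow> arr f N N \<Longrightarrow> arr g N N \<Longrightarrow> mor_eq R N N f g"
| eq_refl: "arr f m n \<Longrightarrow> mor_eq R m n f f"
| eq_sym: "mor_eq R m n f g \<Longrightarrow> mor_eq R m n g f"
| eq_trans: "mor_eq R m n f g \<Longrightarrow> mor_eq R m n g h \<Longrightarrow> mor_eq R m n f h"
| eq_Comp: "mor_eq R k m f f' \<Longrightarrow> mor_eq R m n g g' \<Longrightarrow> mor_eq R k n (g \<cdot> f) (g' \<cdot> f')"
| eq_Tensor: "mor_eq R m n f f' \<Longrightarrow> mor_eq R m' n' g g'
    \<Longrightarrow> mor_eq R (m + m') (n + n') (f \<otimes>\<^sub>t g) (f' \<otimes>\<^sub>t g')"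
| comp_unit_left: "arr f m n \<Longrightarrow> mor_eq R m n (Ident n \<cdot> f) f"
| comp_unit_right: "arr f m n \<Longrightarrow> mor_eq R m n (f \<cdot> Ident m) f"
| comp_assoc: "arr f k l \<Longrightarrow> arr g l m \<Longrightarrow> arr h m n
    \<Longrightarrow> mor_eq R k n ((h \<cdot> g) \<cdot> f) (h \<cdot> (g \<cdot> f))"
| tensor_unit_left: "arr f m n \<Longrightarrow> mor_eq R m n (Ident 0 \<otimes>\<^sub>t f) f"
| tensor_unit_right: "arr f m n \<Longrightarrow> mor_eq R m n (f \<otimes>\<^sub>t Ident 0) f"
| tensor_assoc: "arr f m n \<Longrightarrow> arr g m' n' \<Longrightarrow> arr h m'' n''
    \<Longrightarrow> mor_eq R (m + m' + m'') (n + n' + n'') ((f \<otimes>\<^sub>t g) \<otimes>\<^sub>t h) (f \<otimes>\<^sub>t (g \<otimes>\<^sub>t h))"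
| tensor_Ident: "mor_eq R (m + n) (m + n) (Ident m \<otimes>\<^sub>t Ident n) (Ident (m + n))"
| interchange: "arr f k m \<Longrightarrow> arr g m n \<Longrightarrow> arr f' k' m' \<Longrightarrow> arr g' m' n'
    \<Longrightarrow> mor_eq R (k + k') (n + n') ((g \<cdot> f) \<otimes>\<^sub>t (g' \<cdot> f')) ((g \<otimes>\<^sub>t g') \<cdot> (f \<otimes>\<^sub>t f'))"

definition mor_class ::
  "(nat \<Rightarrow> sc_term \<Rightarrow> sc_term \<Rightarrow> bool) \<Rightarrow> nat \<Rightarrow> nat \<Rightarrow> sc_term \<Rightarrow> sc_term set" where
  "mor_class R m n f = {g. mor_eq R m n f g}"

definition hom_set ::
  "(nat \<Rightarrow> sc_term \<Rightarrow> sc_term \<Rightarrow> bool) \<Rightarrow> nat \<Rightarrow> nat \<Rightarrow> sc_term set set" where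
  "hom_set R m n = {mor_class R m n f |f. arr f m n}"

definition end_monoid ::
  "(nat \<Rightarrow> sc_term \<Rightarrow> sc_term \<Rightarrow> bool) \<Rightarrow> nat \<Rightarrow> sc_term set monoid" where
  "end_monoid R n =
    \<lparr>carrier = hom_set R n n,
     mult = (\<lambda>G F. \<Union>g\<in>G. \<Union>f\<in>F. mor_class R n n (g \<cdot> f)),
     one = mor_class R n n (Ident n)\<rparr>"

lemma mor_eq_arr: "mor_eq R m n f g \<Longrightarrow> arr f m n \<and> arr g m n"
proof (induction rule: mor_eq.induct)
  case (tensor_unit_left f m n)
  then show ?case using arr_Tensor[OF arr_Ident[of 0], of f m n] by simp
next
  case (tensor_unit_right f m n)
  then show ?case using arr_Tensor[OF _ arr_Ident[of 0], of f m n] by simp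
next
  case (tensor_assoc f m n g m' n' h m'' n'')
  then have "arr ((f \<otimes>\<^sub>t g) \<otimes>\<^sub>t h) (m + m' + m'') (n + n' + n'')"
    "arr (f \<otimes>\<^sub>t (g \<otimes>\<^sub>t h)) (m + (m' + m'')) (n + (n' + n''))"
    by (blast intro: arr_Tensor)+
  then show ?case by (simp add: add.assoc)
qed (blast intro: arr.intros)+

lemma mor_class_eq_iff:
  assumes "arr f m n"
  shows "mor_class R m n f = mor_class R m n g \<longleftrightarrow> mor_eq R m n f g"
  unfolding mor_class_def using assms by (auto intro: mor_eq.intros)

lemma end_monoid_mult_class:
  assumes "arr f n n" "arr g n n"
  shows "mult (end_monoid R n) (mor_class R n n g) (mor_class R n n f) = mor_class R n n (g \<cdot> f)"
proof -
  have "mor_class R n n (g' \<cdot> f') = mor_class R n n (g \<cdot> f)"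
    if "mor_eq R n n g g'" "mor_eq R n n f f'" for g' f'
  proof -
    from that have "mor_eq R n n (g \<cdot> f) (g' \<cdot> f')" by (blast intro: eq_Comp)
    then show ?thesis using mor_class_eq_iff mor_eq_arr by metis
  qed
  moreover have "f \<in> mor_class R n n f" "g \<in> mor_class R n n g"
    using assms by (auto simp: mor_class_def intro: eq_refl)
  moreover have "mor_eq R n n h h'" if "h' \<in> mor_class R n n h" for h h'
    using that by (simp add: mor_class_def)
  ultimately show ?thesis
    unfolding end_monoid_def monoid.simps by blast
qed


section \<open>The string category\<close>

text \<open>\<open>v_at N i\<close> and \<open>mu12 N\<close> are the endomorphisms \<open>v_i\<close> and \<open>\<mu>_12\<close> of \<open>N\<close>; they are meant only
  for \<open>1 \<le> i < N\<close> and \<open>2 \<le> N\<close>.\<close>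

definition v_at :: "nat \<Rightarrow> nat \<Rightarrow> sc_term" where
  "v_at N i = Ident (i - 1) \<otimes>\<^sub>t V \<otimes>\<^sub>t Ident (N - i - 1)"

definition mu12 :: "nat \<Rightarrow> sc_term" where
  "mu12 N = Mu \<otimes>\<^sub>t Ident (N - 2)"

inductive string_rel :: "nat \<Rightarrow> sc_term \<Rightarrow> sc_term \<Rightarrow> bool" where
  mu_mu': "string_rel 2 (Mu \<cdot> Mu') (Ident 2)"
| mu'_mu: "string_rel 2 (Mu' \<cdot> Mu) (Ident 2)"
| v_v: "string_rel 2 (V \<cdot> V) (Ident 2)"
| mu_far: "2 < j \<Longrightarrow> j < N \<Longrightarrow> string_rel N (mu12 N \<cdot> v_at N j) (v_at N j \<cdot> mu12 N)"
| yang_baxter: "3 \<le> N \<Longrightarrow> string_rel N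
    (mu12 N \<cdot> v_at N 2 \<cdot> mu12 N \<cdot> v_at N 2 \<cdot> v_at N 1 \<cdot> v_at N 2 \<cdot> mu12 N \<cdot> v_at N 2 \<cdot> v_at N 1)
    (v_at N 1 \<cdot> v_at N 2 \<cdot> mu12 N \<cdot> v_at N 2 \<cdot> v_at N 1 \<cdot> v_at N 2 \<cdot> mu12 N \<cdot> v_at N 2 \<cdot> mu12 N)"
| mu_mu_far: "4 \<le> N \<Longrightarrow> string_rel N
    (mu12 N \<cdot> v_at N 2 \<cdot> v_at N 3 \<cdot> v_at N 1 \<cdot> v_at N 2 \<cdot> mu12 N \<cdot> v_at N 2 \<cdot> v_at N 1 \<cdot> v_at N 3 \<cdot> v_at N 2)
    (v_at N 2 \<cdot> v_at N 3 \<cdot> v_at N 1 \<cdot> v_at N 2 \<cdot> mu12 N \<cdot> v_at N 2 \<cdot> v_at N 1 \<cdot> v_at N 3 \<cdot> v_at N 2 \<cdot> mu12 N)"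
| v_braid: "1 \<le> i \<Longrightarrow> i + 1 < N \<Longrightarrow> string_rel N
    (v_at N i \<cdot> v_at N (i + 1) \<cdot> v_at N i) (v_at N (i + 1) \<cdot> v_at N i \<cdot> v_at N (i + 1))"
| v_far: "i \<in> {1..<N} \<Longrightarrow> j \<in> {1..<N} \<Longrightarrow> j \<noteq> i + 1 \<Longrightarrow> i \<noteq> j + 1 \<Longrightarrow> string_rel N
    (v_at N i \<cdot> v_at N j) (v_at N j \<cdot> v_at N i)"

text \<open>The defining list \<open>string_rel\<close> relates \<open>\<mu>\<close> on strands 1, 2 to its conjugates by the \<open>v_i\<close>,
  but never to the morphism \<open>id \<otimes> \<mu>\<close>, which a monoidal category containing \<open>\<mu>\<close> also has. The
  quotient by \<open>string_rel\<close> alone leaves it independent: the exponent sum of \<open>\<mu>\<close> in each position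
  is invariant under \<open>string_rel\<close> and the monoidal axioms, so that the automorphism group of 3
  maps onto \<open>\<int>\<^sup>2\<close>, which the virtual braid group on 3 strands does not. The convention that
  \<open>\<mu>\<close> placed on strands 2, 3 is \<open>v_1 v_2 \<mu>_12 v_2 v_1\<close> (as the Yang-Baxter relation
  presupposes) is therefore imposed as a further relation. It is the counterpart for \<open>\<mu>\<close> of the
  relation \<open>v_i \<sigma>_{i+1} v_i = v_{i+1} \<sigma>_i v_{i+1}\<close> of the virtual braid group.\<close>

inductive slide_rel :: "nat \<Rightarrow> sc_term \<Rightarrow> sc_term \<Rightarrow> bool" where
  slide: "slide_rel 3 (Ident 1 \<otimes>\<^sub>t Mu) (v_at 3 1 \<cdot> v_at 3 2 \<cdot> mu12 3 \<cdot> v_at 3 2 \<cdot> v_at 3 1)"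

definition SC_rel :: "nat \<Rightarrow> sc_term \<Rightarrow> sc_term \<Rightarrow> bool" where
  "SC_rel N f g \<longleftrightarrow> string_rel N f g \<or> slide_rel N f g"

definition SC_end :: "nat \<Rightarrow> sc_term set monoid" where
  "SC_end n = end_monoid SC_rel n"

lemma arr_v: "1 \<le> i \<Longrightarrow> i < N \<Longrightarrow> arr (v_at N i) N N"
proof -
  assume "1 \<le> i" "i < N"
  then have "i - 1 + (2 + (N - i - 1)) = N" by simp
  then show ?thesis
    using arr_Tensor[OF arr_Ident[of "i - 1"] arr_Tensor[OF arr_V arr_Ident[of "N - i - 1"]]]
    unfolding v_at_def by metis
qed

lemma arr_mu12: "2 \<le> N \<Longrightarrow> arr (mu12 N) N N"
  using arr_Tensor[OF arr_Mu arr_Ident[of "N - 2"]] unfolding mu12_def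
  by (metis le_add_diff_inverse)

text \<open>All relations are between well-typed terms, so the typing premises of the congruence discard
  none of them.\<close>

lemma SC_rel_arr:
  assumes "SC_rel N f g"
  shows "arr f N N \<and> arr g N N"
proof -
  have "string_rel N f g \<Longrightarrow> ?thesis"
    by (induction rule: string_rel.induct) (auto intro!: arr_Comp arr_v arr_mu12 intro: arr.intros)
  moreover have "slide_rel N f g \<Longrightarrow> ?thesis"
  proof (induction rule: slide_rel.induct)
    case slide
    have "arr (Ident 1 \<otimes>\<^sub>t Mu) 3 3"
      using arr_Tensor[OF arr_Ident[of 1] arr_Mu] by (simp only: one_plus_numeral semiring_norm)
    moreover have "arr (v_at 3 1) 3 3" "arr (v_at 3 2) 3 3" "arr (mu12 3) 3 3"
      using arr_v[of 1 3] arr_v[of 2 3] arr_mu12[of 3] by simp_all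
    ultimately show ?case by (blast intro: arr_Comp)
  qed
  ultimately show ?thesis using assms unfolding SC_rel_def by blast
qed

lemma arr_endo: "arr f m n \<Longrightarrow> m = n"
  by (induction rule: arr.induct) auto

lemmas [trans] = eq_trans

lemma arr_invertible:
  assumes "arr f m n" and R: "\<And>N f g. string_rel N f g \<Longrightarrow> R N f g"
  shows "\<exists>g. arr g n m \<and> mor_eq R m m (g \<cdot> f) (Ident m)"
  using assms(1)
proof (induction rule: arr.induct)
  case (arr_Ident n)
  then show ?case by (meson arr.arr_Ident comp_unit_left)
next
  case arr_Mu
  have "mor_eq R 2 2 (Mu' \<cdot> Mu) (Ident 2)"
    by (rule eq_rel) (auto intro!: R mu'_mu intro: arr.intros)
  then show ?case using arr.arr_Mu' by blast
next
  case arr_Mu'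
  have "mor_eq R 2 2 (Mu \<cdot> Mu') (Ident 2)"
    by (rule eq_rel) (auto intro!: R mu_mu' intro: arr.intros)
  then show ?case using arr.arr_Mu by blast
next
  case arr_V
  have "mor_eq R 2 2 (V \<cdot> V) (Ident 2)"
    by (rule eq_rel) (auto intro!: R v_v intro: arr.intros)
  then show ?case using arr.arr_V by blast
next
  case (arr_Comp f k m g n)
  then obtain f' g' where f': "arr f' m k" "mor_eq R k k (f' \<cdot> f) (Ident k)"
    and g': "arr g' n m" "mor_eq R m m (g' \<cdot> g) (Ident m)" by blast
  have "mor_eq R k m (g' \<cdot> g \<cdot> f) ((g' \<cdot> g) \<cdot> f)"
    using arr_Comp g' by (blast intro: comp_assoc eq_sym)
  also have "mor_eq R k m ((g' \<cdot> g) \<cdot> f) (Ident m \<cdot> f)"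
    using arr_Comp g' by (blast intro: eq_Comp eq_refl)
  also have "mor_eq R k m (Ident m \<cdot> f) f"
    using arr_Comp by (blast intro: comp_unit_left)
  finally have *: "mor_eq R k m (g' \<cdot> g \<cdot> f) f" .
  have "mor_eq R k k ((f' \<cdot> g') \<cdot> g \<cdot> f) (f' \<cdot> g' \<cdot> g \<cdot> f)"
    using arr_Comp g' f' by (blast intro: comp_assoc arr.arr_Comp)
  also have "mor_eq R k k (f' \<cdot> g' \<cdot> g \<cdot> f) (f' \<cdot> f)"
    using * f' by (blast intro: eq_Comp eq_refl)
  also note f'(2)
  finally show ?case using f' g' arr.arr_Comp by blast
next
  case (arr_Tensor f m n g p q)
  then obtain f' g' where f': "arr f' n m" "mor_eq R m m (f' \<cdot> f) (Ident m)"
    and g': "arr g' q p" "mor_eq R p p (g' \<cdot> g) (Ident p)" by blast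
  have "mor_eq R (m + p) (m + p) ((f' \<otimes>\<^sub>t g') \<cdot> (f \<otimes>\<^sub>t g)) ((f' \<cdot> f) \<otimes>\<^sub>t (g' \<cdot> g))"
    using arr_Tensor f' g' by (blast intro: interchange eq_sym)
  also have "mor_eq R (m + p) (m + p) ((f' \<cdot> f) \<otimes>\<^sub>t (g' \<cdot> g)) (Ident m \<otimes>\<^sub>t Ident p)"
    using f' g' by (blast intro: eq_Tensor)
  also note tensor_Ident
  finally show ?case using f' g' arr.arr_Tensor by blast
qed

lemma group_end_monoid:
  assumes R: "\<And>N f g. string_rel N f g \<Longrightarrow> R N f g"
  shows "group (end_monoid R n)"
proof (rule groupI)
  note em = end_monoid_mult_class
  let ?M = "end_monoid R n"
  have car: "A \<in> carrier ?M \<longleftrightarrow> (\<exists>f. arr f n n \<and> A = mor_class R n n f)" for A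
    by (auto simp: end_monoid_def hom_set_def)
  have one: "one ?M = mor_class R n n (Ident n)" by (simp add: end_monoid_def)
  show "mult ?M A B \<in> carrier ?M" if "A \<in> carrier ?M" "B \<in> carrier ?M" for A B
    using that unfolding car by (metis em arr_Comp)
  show "one ?M \<in> carrier ?M" unfolding car one by (blast intro: arr_Ident)
  show "mult ?M (mult ?M A B) C = mult ?M A (mult ?M B C)"
    if abc: "A \<in> carrier ?M" "B \<in> carrier ?M" "C \<in> carrier ?M" for A B C
  proof -
    from abc obtain f g h where "arr f n n" "arr g n n" "arr h n n"
      "A = mor_class R n n f" "B = mor_class R n n g" "C = mor_class R n n h"
      unfolding car by blast
    then show ?thesis by (simp add: em arr_Comp mor_class_eq_iff comp_assoc)
  qed
  show "mult ?M (one ?M) A = A" if a: "A \<in> carrier ?M" for A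
  proof -
    from a obtain f where "arr f n n" "A = mor_class R n n f" unfolding car by blast
    then show ?thesis by (simp add: one em arr_Ident arr_Comp mor_class_eq_iff comp_unit_left)
  qed
  show "\<exists>B\<in>carrier ?M. mult ?M B A = one ?M" if a: "A \<in> carrier ?M" for A
  proof -
    from a obtain f where f: "arr f n n" "A = mor_class R n n f" unfolding car by blast
    obtain g where g: "arr g n n" "mor_eq R n n (g \<cdot> f) (Ident n)"
      using arr_invertible[of f n n R] f(1) R by blast
    then have "mult ?M (mor_class R n n g) A = one ?M"
      using f by (simp add: one em arr_Comp mor_class_eq_iff)
    then show ?thesis using g(1) car by blast
  qed
qed

lemma group_SC_end: "group (SC_end n)"
  unfolding SC_end_def by (rule group_end_monoid) (simp add: SC_rel_def)

end

theory Submission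
  imports Defs
begin

text \<open>Put \<open>\<sigma>\<^sub>i = \<mu>\<^sub>i v\<^sub>i\<close>, where \<open>\<mu>\<^sub>i\<close> is \<open>\<mu>\<close> on the factors \<open>i\<close>, \<open>i + 1\<close>. Once \<open>\<mu>\<^sub>2 = v\<^sub>1 v\<^sub>2 \<mu>\<^sub>1 v\<^sub>2 v\<^sub>1\<close>
  (M1), the braid relation for \<open>\<sigma>\<close> is the Yang-Baxter equation for \<open>\<mu>\<close> multiplied on the right by
  \<open>v\<^sub>1 v\<^sub>2 v\<^sub>1\<close>, and all relations between distant factors amount to the interchange law. Hence
  the string category satisfies the virtual braid relations, and conversely a term can be evaluated
  in any group with elements satisfying these relations, in particular in \<open>VB\<^sub>n\<close>. The two resulting
  homomorphisms are mutually inverse because they are so on generators.\<close>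

section \<open>Homomorphisms out of presented groups\<close>

fun word_eval :: "('a, 'b) monoid_scheme \<Rightarrow> ('g \<Rightarrow> 'a) \<Rightarrow> 'g word \<Rightarrow> 'a" where
  "word_eval G g [] = \<one>\<^bsub>G\<^esub>"
| "word_eval G g ((x, b) # u) = (if b then g x else inv\<^bsub>G\<^esub> g x) \<otimes>\<^bsub>G\<^esub> word_eval G g u"

context group
begin

lemma word_eval_closed [simp]:
  "g ` S \<subseteq> carrier G \<Longrightarrow> u \<in> words S \<Longrightarrow> word_eval G g u \<in> carrier G"
proof (induction u)
  case (Cons x u)
  then show ?case by (cases x) auto
qed simp

lemma word_eval_append:
  "g ` S \<subseteq> carrier G \<Longrightarrow> u \<in> words S \<Longrightarrow> w \<in> words S
    \<Longrightarrow> word_eval G g (u @ w) = word_eval G g u \<otimes> word_eval G g w"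
proof (induction u)
  case (Cons x u)
  then have "word_eval G g u \<in> carrier G" "word_eval G g w \<in> carrier G" by auto
  with Cons show ?case by (cases x) (auto simp: m_assoc image_subset_iff)
qed simp

lemma hom_word_eval:
  assumes "group H" "h \<in> hom G H" "g ` S \<subseteq> carrier G" "\<And>x. x \<in> S \<Longrightarrow> h (g x) = g' x"
    and "u \<in> words S"
  shows "h (word_eval G g u) = word_eval H g' u"
proof -
  interpret h: group_hom G H h
    using assms(1,2) is_group by (simp add: group_hom_def group_hom_axioms_def)
  show ?thesis
    using assms(5)
  proof (induction u)
    case (Cons x u)
    then have "word_eval G g u \<in> carrier G" using assms(3) by auto
    with Cons assms(3,4) show ?case by (cases x) (auto simp: image_subset_iff)
  qed simp
qed

lemma word_eval_cong:
  assumes g: "g ` S \<subseteq> carrier G"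
    and R: "\<And>u w. (u, w) \<in> R \<Longrightarrow> word_eval G g u = word_eval G g w"
    and "(u, w) \<in> pres_cong S R"
  shows "word_eval G g u = word_eval G g w"
  using assms(3)
proof (induction rule: pres_cong.induct)
  case (pres_cancel x b)
  then show ?case using g by auto
next
  case (pres_append u u' w w')
  then show ?case by (metis g pres_cong_words word_eval_append)
qed (auto dest: R)

text \<open>The universal property of a presentation (von Dyck). Evaluation is constant on each
  congruence class, so the image of a class is a singleton and \<open>the_elem\<close> gives the
  value without choosing a representative.\<close>

lemma presented_group_hom:
  assumes g: "g ` S \<subseteq> carrier G"
    and R: "\<And>u w. (u, w) \<in> R \<Longrightarrow> word_eval G g u = word_eval G g w"
  obtains h where "h \<in> hom (presented_group S R) G"
    "\<And>u. u \<in> words S \<Longrightarrow> h (pres_cong S R `` {u}) = word_eval G g u"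
proof
  let ?h = "\<lambda>A. the_elem (word_eval G g ` A)"
  show eval: "?h (pres_cong S R `` {u}) = word_eval G g u" if "u \<in> words S" for u
  proof -
    have "word_eval G g w = word_eval G g u" if "(u, w) \<in> pres_cong S R" for w
      using word_eval_cong[OF g R that] by simp
    moreover have "u \<in> pres_cong S R `` {u}" using pres_refl[OF that] by simp
    ultimately have "word_eval G g ` (pres_cong S R `` {u}) = {word_eval G g u}" by blast
    then show ?thesis by simp
  qed
  show "?h \<in> hom (presented_group S R) G"
  proof (rule homI)
    fix A B assume "A \<in> carrier (presented_group S R)" "B \<in> carrier (presented_group S R)"
    then obtain u w where u: "u \<in> words S" "A = pres_cong S R `` {u}"
      and w: "w \<in> words S" "B = pres_cong S R `` {w}"
      by (auto simp: presented_group_def quotient_def)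
    then show "?h A \<in> carrier G" using g by (simp add: eval)
    show "?h (A \<otimes>\<^bsub>presented_group S R\<^esub> B) = ?h A \<otimes> ?h B"
      using u w g by (simp add: presented_mult_class eval word_eval_append)
  qed
qed

end


section \<open>Families satisfying the virtual braid relations\<close>

context group
begin

lemma cancel_involution:
  assumes "a \<otimes> a = \<one>" "a \<in> carrier G" "x \<in> carrier G"
  shows "a \<otimes> (a \<otimes> x) = x"
  using assms by (simp add: m_assoc[symmetric])

lemma commute_mult:
  assumes "x \<otimes> a = a \<otimes> x" "x \<otimes> b = b \<otimes> x" "x \<in> carrier G" "a \<in> carrier G" "b \<in> carrier G"
  shows "x \<otimes> (a \<otimes> b) = (a \<otimes> b) \<otimes> x"
  using assms by (metis m_assoc)

lemma commute_inv:
  assumes "x \<otimes> a = a \<otimes> x" "x \<in> carrier G" "a \<in> carrier G"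
  shows "x \<otimes> inv a = inv a \<otimes> x"
  using assms by (metis inv_closed inv_solve_left inv_solve_right m_assoc m_closed)

text \<open>In the applications \<open>a\<close>, \<open>b\<close> are two adjacent generators
  \<open>v\<close>, and \<open>m\<close>, \<open>c\<close> are the corresponding two copies of
  \<open>\<mu>\<close>, so that \<open>m \<otimes> a\<close> and \<open>c \<otimes> b\<close> play
  the role of adjacent \<open>\<sigma>\<close>. After expanding \<open>c\<close>, each side of the
  braid equation is the same side of the Yang-Baxter equation times
  \<open>a \<otimes> (b \<otimes> a)\<close>, which cancels. One direction serves to evaluate the
  string relations, the other to build the \<open>\<sigma>\<close> of the string category.\<close>

lemma yang_baxter_iff_braid:
  assumes abm: "a \<in> carrier G" "b \<in> carrier G" "m \<in> carrier G"
    and sq: "a \<otimes> a = \<one>" "b \<otimes> b = \<one>"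
    and braid: "b \<otimes> (a \<otimes> b) = a \<otimes> (b \<otimes> a)"
    and c: "c = a \<otimes> (b \<otimes> (m \<otimes> (b \<otimes> a)))"
  shows "(m \<otimes> a) \<otimes> ((c \<otimes> b) \<otimes> (m \<otimes> a)) = (c \<otimes> b) \<otimes> ((m \<otimes> a) \<otimes> (c \<otimes> b)) \<longleftrightarrow>
    m \<otimes> (b \<otimes> (m \<otimes> (b \<otimes> (a \<otimes> (b \<otimes> (m \<otimes> (b \<otimes> a))))))) =
    a \<otimes> (b \<otimes> (m \<otimes> (b \<otimes> (a \<otimes> (b \<otimes> (m \<otimes> (b \<otimes> m)))))))"
    (is "?l = ?r \<longleftrightarrow> ?l' = ?r'")
proof -
  \<comment> \<open>The braid relation with a tail \<open>x\<close>, as it is met inside a product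
    nested to the right.\<close>
  have braid': "b \<otimes> (a \<otimes> (b \<otimes> x)) = a \<otimes> (b \<otimes> (a \<otimes> x))" if "x \<in> carrier G" for x
    using arg_cong[OF braid, of "\<lambda>y. y \<otimes> x"] abm that by (simp add: m_assoc)
  have "?l = ?l' \<otimes> (a \<otimes> (b \<otimes> a))" "?r = ?r' \<otimes> (a \<otimes> (b \<otimes> a))"
    unfolding c using abm by (simp_all add: m_assoc sq cancel_involution braid braid')
  then show ?thesis using abm by simp
qed

end

text \<open>Both groups of the theorem are instances, so evaluation is developed once for an
  arbitrary target. Distant relations are required for \<open>Suc i < j\<close> only; since (M2) is
  not symmetric in \<open>s\<close> and \<open>v\<close>, it splits into \<open>s_v_far\<close> and
  \<open>v_s_far\<close>.\<close>

locale virtual_braid_family = group G for G (structure) +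
  fixes n :: nat and s v :: "nat \<Rightarrow> 'a"
  assumes s_closed [simp]: "1 \<le> i \<Longrightarrow> i < n \<Longrightarrow> s i \<in> carrier G"
    and v_closed [simp]: "1 \<le> i \<Longrightarrow> i < n \<Longrightarrow> v i \<in> carrier G"
    and s_braid: "1 \<le> i \<Longrightarrow> Suc i < n \<Longrightarrow>
      s i \<otimes> (s (Suc i) \<otimes> s i) = s (Suc i) \<otimes> (s i \<otimes> s (Suc i))"
    and s_far: "1 \<le> i \<Longrightarrow> Suc i < j \<Longrightarrow> j < n \<Longrightarrow> s i \<otimes> s j = s j \<otimes> s i"
    and vv_braid: "1 \<le> i \<Longrightarrow> Suc i < n \<Longrightarrow>
      v i \<otimes> (v (Suc i) \<otimes> v i) = v (Suc i) \<otimes> (v i \<otimes> v (Suc i))"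
    and vv_far: "1 \<le> i \<Longrightarrow> Suc i < j \<Longrightarrow> j < n \<Longrightarrow> v i \<otimes> v j = v j \<otimes> v i"
    and v_v: "1 \<le> i \<Longrightarrow> i < n \<Longrightarrow> v i \<otimes> v i = \<one>"
    and v_s_v: "1 \<le> i \<Longrightarrow> Suc i < n \<Longrightarrow>
      v i \<otimes> (s (Suc i) \<otimes> v i) = v (Suc i) \<otimes> (s i \<otimes> v (Suc i))"
    and s_v_far: "1 \<le> i \<Longrightarrow> Suc i < j \<Longrightarrow> j < n \<Longrightarrow> s i \<otimes> v j = v j \<otimes> s i"
    and v_s_far: "1 \<le> i \<Longrightarrow> Suc i < j \<Longrightarrow> j < n \<Longrightarrow> v i \<otimes> s j = s j \<otimes> v i"
begin

definition gen :: "vb_gen \<Rightarrow> 'a" where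
  "gen x = (case x of Sigma_gen i \<Rightarrow> s i | V_gen i \<Rightarrow> v i)"

lemma gen_simps [simp]: "gen (Sigma_gen i) = s i" "gen (V_gen i) = v i"
  by (simp_all add: gen_def)

lemma gen_closed: "gen ` vb_gens n \<subseteq> carrier G"
  by (auto simp: vb_gens_def)

lemma gen_rels: "(u, w) \<in> vb_rels n \<Longrightarrow> word_eval G gen u = word_eval G gen w"
proof (induction rule: vb_rels.induct)
  case (B2 i j)
  then show ?case using s_far[of i j] s_far[of j i] by (cases "i < j") auto
next
  case (S2 i j)
  then show ?case using vv_far[of i j] vv_far[of j i] by (cases "i < j") auto
next
  case (M2 i j)
  then show ?case using s_v_far[of i j] v_s_far[of j i] by (cases "i < j") auto
qed (simp_all add: s_braid vv_braid v_s_v v_v)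

lemma virtual_braid_group_hom:
  obtains h where "h \<in> hom (virtual_braid_group n) G"
    "\<And>u. u \<in> words (vb_gens n) \<Longrightarrow>
      h (pres_cong (vb_gens n) (vb_rels n) `` {u}) = word_eval G gen u"
  unfolding virtual_braid_group_def
  using presented_group_hom[OF gen_closed gen_rels, of "vb_rels n"] by metis

end


section \<open>Evaluation of string category terms\<close>

text \<open>The source of a well-typed term, as a total function on raw terms: evaluation by
  structural recursion needs it to find where the right factor of a tensor product starts.\<close>

fun width :: "sc_term \<Rightarrow> nat" where
  "width (Ident n) = n"
| "width Mu = 2"
| "width Mu' = 2"
| "width V = 2"
| "width (g \<cdot> f) = width f"
| "width (f \<otimes>\<^sub>t g) = width f + width g"

lemma arr_width: "arr f m n \<Longrightarrow> width f = m"
  by (induction rule: arr.induct) auto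

context virtual_braid_family
begin

text \<open>\<open>\<mu>\<close> satisfies the Yang-Baxter equation in the form \<open>\<mu>\<^sub>1\<^sub>2\<mu>\<^sub>1\<^sub>3\<mu>\<^sub>2\<^sub>3 = \<mu>\<^sub>2\<^sub>3\<mu>\<^sub>1\<^sub>3\<mu>\<^sub>1\<^sub>2\<close>, not the
  braid equation, so that it corresponds to \<open>\<sigma>v\<close> rather than to \<open>\<sigma>\<close>.\<close>

fun sc_eval :: "nat \<Rightarrow> sc_term \<Rightarrow> 'a" where
  "sc_eval k (Ident m) = \<one>"
| "sc_eval k Mu = s (Suc k) \<otimes> v (Suc k)"
| "sc_eval k Mu' = inv (s (Suc k) \<otimes> v (Suc k))"
| "sc_eval k V = v (Suc k)"
| "sc_eval k (g \<cdot> f) = sc_eval k g \<otimes> sc_eval k f"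
| "sc_eval k (f \<otimes>\<^sub>t g) = sc_eval k f \<otimes> sc_eval (k + width f) g"

lemma sc_eval_closed [simp]: "arr f m m' \<Longrightarrow> k + m \<le> n \<Longrightarrow> sc_eval k f \<in> carrier G"
  by (induction arbitrary: k rule: arr.induct) (auto dest: arr_endo arr_width)

text \<open>A term of width \<open>m\<close> at offset \<open>k\<close> evaluates to a product of
  \<open>s i\<close>, \<open>v i\<close> and their inverses with \<open>k < i < k + m\<close>
  only.\<close>

lemma commute_sc_eval:
  assumes "arr f m m'" "k + m \<le> n" "x \<in> carrier G"
    and "\<And>i. k < i \<Longrightarrow> i < k + m \<Longrightarrow> x \<otimes> s i = s i \<otimes> x"
    and "\<And>i. k < i \<Longrightarrow> i < k + m \<Longrightarrow> x \<otimes> v i = v i \<otimes> x"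
  shows "x \<otimes> sc_eval k f = sc_eval k f \<otimes> x"
  using assms
proof (induction arbitrary: k rule: arr.induct)
  case arr_Mu
  then show ?case by (simp add: commute_mult)
next
  case arr_Mu'
  then show ?case by (simp add: commute_mult commute_inv)
next
  case (arr_Comp f k' m g n)
  then have "k' = m" by (auto dest: arr_endo)
  with arr_Comp show ?case by (simp add: commute_mult)
next
  case (arr_Tensor f m n g m' n')
  then show ?case using arr_width[OF arr_Tensor(1)] by (simp add: commute_mult)
qed simp_all

text \<open>The image of the interchange law. Indices used by \<open>f\<close> are at most
  \<open>k + m - 1\<close> and those used by \<open>g\<close> at least \<open>l + 1\<close>, so
  disjoint blocks, even touching ones, have indices at distance at least 2. The previous lemma is
  applied twice: to move a single generator past \<open>f\<close>, then to move \<open>f\<close>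
  past \<open>g\<close>.\<close>

lemma sc_eval_commute:
  assumes "arr f m m'" "arr g p p'" "k + m \<le> l" "l + p \<le> n"
  shows "sc_eval k f \<otimes> sc_eval l g = sc_eval l g \<otimes> sc_eval k f"
proof (rule commute_sc_eval[OF assms(2,4)])
  have *: "s i \<otimes> sc_eval k f = sc_eval k f \<otimes> s i" "v i \<otimes> sc_eval k f = sc_eval k f \<otimes> v i"
    if "l < i" "i < l + p" for i
    using that assms(3,4)
    by (auto intro!: commute_sc_eval[OF assms(1)]
        intro: s_far[symmetric] vv_far[symmetric] s_v_far[symmetric] v_s_far[symmetric])
  show "sc_eval k f \<otimes> s i = s i \<otimes> sc_eval k f" "sc_eval k f \<otimes> v i = v i \<otimes> sc_eval k f"
    if "l < i" "i < l + p" for i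
    using *[OF that] by simp_all
qed (use assms in auto)

text \<open>Naturality of evaluation in the target group: a homomorphism that matches the generators
  matches all evaluated terms.\<close>

lemma hom_sc_eval:
  assumes "virtual_braid_family H n s' v'" "h \<in> hom G H"
    and s': "\<And>i. 1 \<le> i \<Longrightarrow> i < n \<Longrightarrow> h (s i) = s' i"
    and v': "\<And>i. 1 \<le> i \<Longrightarrow> i < n \<Longrightarrow> h (v i) = v' i"
    and "arr f m m'" "k + m \<le> n"
  shows "h (sc_eval k f) = virtual_braid_family.sc_eval H s' v' k f"
proof -
  interpret H: virtual_braid_family H n s' v' by fact
  interpret h: group_hom G H h using assms(2) by unfold_locales
  show ?thesis
    using assms(5,6)
  proof (induction arbitrary: k rule: arr.induct)
    case (arr_Comp f k' m g m')
    then have "k' = m" by (auto dest: arr_endo)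
    with arr_Comp show ?case by simp
  next
    case (arr_Tensor f m m' g p p')
    then show ?case using arr_width[OF arr_Tensor(1)] by simp
  qed (simp_all add: s' v')
qed

section \<open>Evaluation respects the relations of the string category\<close>

lemma sc_eval_v_at: "1 \<le> i \<Longrightarrow> k + i < n \<Longrightarrow> sc_eval k (v_at N i) = v (k + i)"
  by (simp add: v_at_def)

lemma sc_eval_mu12: "Suc k < n \<Longrightarrow> sc_eval k (mu12 N) = s (Suc k) \<otimes> v (Suc k)"
  by (simp add: mu12_def)

lemma vv_braid_assoc:
  assumes "1 \<le> i" "Suc i < n" "x \<in> carrier G"
  shows "v (Suc i) \<otimes> (v i \<otimes> (v (Suc i) \<otimes> x)) = v i \<otimes> (v (Suc i) \<otimes> (v i \<otimes> x))"
  using arg_cong[OF vv_braid[of i], of "\<lambda>y. y \<otimes> x"] assms by (simp add: m_assoc)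

text \<open>(M1) multiplied by \<open>v i\<close> on both sides.\<close>

lemma s_Suc:
  assumes "1 \<le> i" "Suc i < n"
  shows "s (Suc i) = v i \<otimes> (v (Suc i) \<otimes> (s i \<otimes> (v (Suc i) \<otimes> v i)))"
proof -
  have "s (Suc i) = v i \<otimes> ((v i \<otimes> (s (Suc i) \<otimes> v i)) \<otimes> v i)"
    using assms by (simp add: m_assoc v_v cancel_involution)
  also have "\<dots> = v i \<otimes> ((v (Suc i) \<otimes> (s i \<otimes> v (Suc i))) \<otimes> v i)"
    using v_s_v assms by simp
  finally show ?thesis using assms by (simp add: m_assoc)
qed

text \<open>The slide relation for \<open>\<mu>_i = s i \<otimes> v i\<close>. By
  \<open>s_Suc\<close> the left side ends in
  \<open>v (Suc i) \<otimes> v i \<otimes> v (Suc i)\<close>; the braid relation for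
  \<open>v\<close> turns this into the required tail.\<close>

lemma sv_Suc:
  assumes "1 \<le> i" "Suc i < n"
  shows "s (Suc i) \<otimes> v (Suc i) =
    v i \<otimes> (v (Suc i) \<otimes> ((s i \<otimes> v i) \<otimes> (v (Suc i) \<otimes> v i)))"
  using assms by (simp add: s_Suc m_assoc vv_braid_assoc vv_braid[symmetric] v_v cancel_involution)

text \<open>The offset \<open>k\<close> is arbitrary because a relation may be applied to any factor
  of a tensor product.\<close>

lemma sc_eval_rel:
  assumes "SC_rel N f g" "k + N \<le> n"
  shows "sc_eval k f = sc_eval k g"
proof -
  have ?thesis if "string_rel N f g"
    using that assms(2)
  proof (induction rule: string_rel.induct)
    case (mu_far j N)
    then have "v (k + j) \<otimes> (s (Suc k) \<otimes> v (Suc k)) = s (Suc k) \<otimes> v (Suc k) \<otimes> v (k + j)"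
      by (intro commute_mult s_v_far[symmetric] vv_far[symmetric]) auto
    with mu_far show ?case by (simp add: sc_eval_v_at sc_eval_mu12)
  next
    case (yang_baxter N)
    let ?a = "v (Suc k)" and ?b = "v (Suc (Suc k))" and ?m = "s (Suc k) \<otimes> v (Suc k)"
    have sv: "s i \<otimes> v i \<otimes> v i = s i" if "1 \<le> i" "i < n" for i
      using that by (simp add: m_assoc v_v)
    have "?m \<otimes> (?b \<otimes> (?m \<otimes> (?b \<otimes> (?a \<otimes> (?b \<otimes> (?m \<otimes> (?b \<otimes> ?a))))))) =
      ?a \<otimes> (?b \<otimes> (?m \<otimes> (?b \<otimes> (?a \<otimes> (?b \<otimes> (?m \<otimes> (?b \<otimes> ?m)))))))"
    \<comment> \<open>Here \<open>c\<close> is \<open>s (Suc (Suc k)) \<otimes> ?b\<close>, written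
      as a conjugate of \<open>?m\<close> by \<open>sv_Suc\<close>. The doubled \<open>v\<close>
      cancel, and the goal becomes the braid relation for \<open>s\<close>.\<close>
    proof (subst yang_baxter_iff_braid[symmetric, OF _ _ _ _ _ _ sv_Suc])
      show "(?m \<otimes> ?a) \<otimes> ((s (Suc (Suc k)) \<otimes> ?b \<otimes> ?b) \<otimes> (?m \<otimes> ?a)) =
        (s (Suc (Suc k)) \<otimes> ?b \<otimes> ?b) \<otimes> ((?m \<otimes> ?a) \<otimes> (s (Suc (Suc k)) \<otimes> ?b \<otimes> ?b))"
        using yang_baxter s_braid[of "Suc k"] by (simp add: sv)
    qed (use yang_baxter v_v vv_braid in auto)
    then show ?case using yang_baxter by (simp add: sc_eval_v_at sc_eval_mu12)
  next
    case (mu_mu_far N)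
    let ?a = "v (Suc k)" and ?b = "v (Suc (Suc k))" and ?c = "v (Suc (Suc (Suc k)))"
    let ?m = "s (Suc k) \<otimes> v (Suc k)" and ?m3 = "s (Suc (Suc (Suc k))) \<otimes> ?c"
    \<comment> \<open>Sliding \<open>\<mu>\<close> twice takes it from the first two strands of the
      block to the third and fourth. The long word in the relation is therefore \<open>?m3\<close>,
      and the relation says that two copies of \<open>\<mu>\<close> on disjoint strands
      commute.\<close>
    have m3: "?m3 = ?b \<otimes> (?c \<otimes> (?a \<otimes> (?b \<otimes> (?m \<otimes> (?b \<otimes> (?a \<otimes> (?c \<otimes> ?b)))))))"
      using mu_mu_far by (simp add: sv_Suc[of "Suc (Suc k)"] sv_Suc[of "Suc k"] m_assoc)
    have "?m \<otimes> ?m3 = ?m3 \<otimes> ?m"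
      using sc_eval_commute[OF arr_Mu arr_Mu, of k "Suc (Suc k)"] mu_mu_far by simp
    then show ?case using mu_mu_far unfolding m3
      by (simp add: sc_eval_v_at sc_eval_mu12 m_assoc eval_nat_numeral)
  next
    case (v_braid i N)
    then show ?case using vv_braid[of "k + i"] by (simp add: sc_eval_v_at)
  next
    case (v_far i N j)
    then show ?case using vv_far[of "k + i" "k + j"] vv_far[of "k + j" "k + i"]
      \<comment> \<open>The relation admits \<open>i = j\<close>, where it is trivial.\<close>
      by (cases i j rule: linorder_cases) (auto simp: sc_eval_v_at)
  qed (simp_all add: v_v)
  moreover have ?thesis if "slide_rel N f g"
    using that assms(2)
  proof (induction rule: slide_rel.induct)
    case slide
    then show ?case by (simp add: sc_eval_v_at sc_eval_mu12 sv_Suc)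
  qed
  ultimately show ?thesis using assms(1) by (auto simp: SC_rel_def)
qed

lemma sc_eval_cong:
  assumes "mor_eq SC_rel m m' f g" "k + m \<le> n"
  shows "sc_eval k f = sc_eval k g"
  using assms
proof (induction arbitrary: k rule: mor_eq.induct)
  case (eq_rel N f g)
  then show ?case by (blast intro: sc_eval_rel)
next
  case (eq_sym m n f g)
  then show ?case by simp
next
  case (eq_trans m n f g h)
  then show ?case by simp
next
  case (eq_Comp k m f f' n g g')
  then show ?case using arr_endo mor_eq_arr by (metis sc_eval.simps(5))
next
  case (eq_Tensor m n f f' m' n' g g')
  then have "width f = m" "width f' = m" using arr_width mor_eq_arr by blast+
  then show ?case using eq_Tensor by simp
next
  case (comp_assoc f k' l g m h n)
  then have "k' = l" "l = m" by (auto dest: arr_endo)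
  then show ?case using comp_assoc by (simp add: m_assoc)
next
  case (tensor_assoc f m n g m' n' h m'' n'')
  then have "width f = m" "width g = m'" using arr_width by blast+
  then show ?case using tensor_assoc by (simp add: m_assoc add.assoc)
next
  case (interchange f k' m g n f' k'' m' g' n')
  then have eq: "k' = m" "k'' = m'" "width f = m" "width g = m" by (auto dest: arr_endo arr_width)
  \<comment> \<open>The two sides of the interchange law differ by the order of \<open>f\<close> and
    \<open>g'\<close>, which occupy disjoint blocks.\<close>
  have "sc_eval (k + m) g' \<otimes> (sc_eval k f \<otimes> sc_eval (k + m) f') =
    sc_eval k f \<otimes> (sc_eval (k + m) g' \<otimes> sc_eval (k + m) f')"
    using interchange eq sc_eval_commute[of f m m g' m' n' k "k + m"]
    by (simp flip: m_assoc)
  then show ?case using interchange eq by (simp add: m_assoc)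
qed simp_all

end


section \<open>Endomorphisms acting on a block of adjacent factors\<close>

lemma Ident_tensor_Comp:
  assumes "arr f m m" "arr g m m"
  shows "mor_eq R (a + m) (a + m) (Ident a \<otimes>\<^sub>t (g \<cdot> f)) ((Ident a \<otimes>\<^sub>t g) \<cdot> (Ident a \<otimes>\<^sub>t f))"
proof -
  have "mor_eq R (a + m) (a + m) (Ident a \<otimes>\<^sub>t (g \<cdot> f)) ((Ident a \<cdot> Ident a) \<otimes>\<^sub>t (g \<cdot> f))"
    using assms by (intro eq_Tensor eq_sym[OF comp_unit_left] eq_refl arr_Comp arr_Ident)
  also have "mor_eq R (a + m) (a + m) \<dots> ((Ident a \<otimes>\<^sub>t g) \<cdot> (Ident a \<otimes>\<^sub>t f))"
    using assms by (blast intro: interchange arr_Ident)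
  finally show ?thesis .
qed

lemma Comp_tensor_Ident:
  assumes "arr f m m" "arr g m m"
  shows "mor_eq R (m + c) (m + c) ((g \<cdot> f) \<otimes>\<^sub>t Ident c) ((g \<otimes>\<^sub>t Ident c) \<cdot> (f \<otimes>\<^sub>t Ident c))"
proof -
  have "mor_eq R (m + c) (m + c) ((g \<cdot> f) \<otimes>\<^sub>t Ident c) ((g \<cdot> f) \<otimes>\<^sub>t (Ident c \<cdot> Ident c))"
    using assms by (intro eq_Tensor eq_sym[OF comp_unit_left] eq_refl arr_Comp arr_Ident)
  also have "mor_eq R (m + c) (m + c) \<dots> ((g \<otimes>\<^sub>t Ident c) \<cdot> (f \<otimes>\<^sub>t Ident c))"
    using assms by (blast intro: interchange arr_Ident)
  finally show ?thesis .
qed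

text \<open>Interchange with identities inserted. Both orders are recorded: comparing them yields
  commutation on disjoint factors.\<close>

lemma tensor_eq_Comp:
  assumes "arr f m m" "arr g p p"
  shows "mor_eq R (m + p) (m + p) (f \<otimes>\<^sub>t g) ((f \<otimes>\<^sub>t Ident p) \<cdot> (Ident m \<otimes>\<^sub>t g))"
    and "mor_eq R (m + p) (m + p) (f \<otimes>\<^sub>t g) ((Ident m \<otimes>\<^sub>t g) \<cdot> (f \<otimes>\<^sub>t Ident p))"
proof -
  have "mor_eq R (m + p) (m + p) (f \<otimes>\<^sub>t g) ((f \<cdot> Ident m) \<otimes>\<^sub>t (Ident p \<cdot> g))"
    using assms by (intro eq_Tensor eq_sym[OF comp_unit_left] eq_sym[OF comp_unit_right])
  also have "mor_eq R (m + p) (m + p) \<dots> ((f \<otimes>\<^sub>t Ident p) \<cdot> (Ident m \<otimes>\<^sub>t g))"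
    using assms by (blast intro: interchange arr_Ident)
  finally show "mor_eq R (m + p) (m + p) (f \<otimes>\<^sub>t g) ((f \<otimes>\<^sub>t Ident p) \<cdot> (Ident m \<otimes>\<^sub>t g))" .
  have "mor_eq R (m + p) (m + p) (f \<otimes>\<^sub>t g) ((Ident m \<cdot> f) \<otimes>\<^sub>t (g \<cdot> Ident p))"
    using assms by (intro eq_Tensor eq_sym[OF comp_unit_left] eq_sym[OF comp_unit_right])
  also have "mor_eq R (m + p) (m + p) \<dots> ((Ident m \<otimes>\<^sub>t g) \<cdot> (f \<otimes>\<^sub>t Ident p))"
    using assms by (blast intro: interchange arr_Ident)
  finally show "mor_eq R (m + p) (m + p) (f \<otimes>\<^sub>t g) ((Ident m \<otimes>\<^sub>t g) \<cdot> (f \<otimes>\<^sub>t Ident p))" .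
qed

section \<open>Padding a term by identities on both sides\<close>

text \<open>The parameter \<open>a\<close> counts the factors to the left of \<open>f\<close>,
  exactly as the offset of \<open>sc_eval\<close> does. The result is an endomorphism of
  \<open>n\<close> for well-typed \<open>f\<close> with \<open>a + width f \<le> n\<close>; beyond
  that the subtraction truncates.\<close>

definition pad :: "nat \<Rightarrow> nat \<Rightarrow> sc_term \<Rightarrow> sc_term" where
  "pad n a f = Ident a \<otimes>\<^sub>t f \<otimes>\<^sub>t Ident (n - a - width f)"

lemma arr_pad:
  assumes "arr f m m" "a + m \<le> n"
  shows "arr (pad n a f) n n"
proof -
  \<comment> \<open>With \<open>c\<close> the number of factors on the right, truncated subtraction
    disappears and the bracketing of the sum agrees with that of the tensor product.\<close>
  from assms obtain c where c: "n = a + (m + c)" by (metis le_Suc_ex add.assoc)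
  show ?thesis unfolding pad_def using assms(1) arr_width[OF assms(1)]
    by (auto simp: c intro!: arr_Tensor arr_Ident)
qed

lemma pad_cong:
  assumes "mor_eq R m m f g" "a + m \<le> n"
  shows "mor_eq R n n (pad n a f) (pad n a g)"
proof -
  from assms obtain c where c: "n = a + (m + c)" by (metis le_Suc_ex add.assoc)
  have "width f = m" "width g = m" using mor_eq_arr[OF assms(1)] arr_width by auto
  then show ?thesis unfolding pad_def using assms(1)
    by (auto simp: c intro!: eq_Tensor eq_refl arr_Ident)
qed

lemma pad_Comp:
  assumes "arr f m m" "arr g m m" "a + m \<le> n"
  shows "mor_eq R n n (pad n a (g \<cdot> f)) (pad n a g \<cdot> pad n a f)"
proof -
  from assms obtain c where c: "n = a + (m + c)" by (metis le_Suc_ex add.assoc)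
  have "mor_eq R n n (Ident a \<otimes>\<^sub>t (g \<cdot> f) \<otimes>\<^sub>t Ident c)
    (Ident a \<otimes>\<^sub>t ((g \<otimes>\<^sub>t Ident c) \<cdot> (f \<otimes>\<^sub>t Ident c)))"
    unfolding c by (intro eq_Tensor eq_refl arr_Ident Comp_tensor_Ident assms)
  also have "mor_eq R n n \<dots>
    ((Ident a \<otimes>\<^sub>t g \<otimes>\<^sub>t Ident c) \<cdot> (Ident a \<otimes>\<^sub>t f \<otimes>\<^sub>t Ident c))"
    unfolding c by (intro Ident_tensor_Comp arr_Tensor arr_Ident assms)
  finally show ?thesis
    using arr_width[OF assms(1)] arr_width[OF assms(2)] by (simp add: pad_def c)
qed

lemma pad_Ident:
  assumes "a + m \<le> n"
  shows "mor_eq R n n (pad n a (Ident m)) (Ident n)"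
proof -
  from assms obtain c where c: "n = a + (m + c)" by (metis le_Suc_ex add.assoc)
  have "mor_eq R n n (Ident a \<otimes>\<^sub>t Ident m \<otimes>\<^sub>t Ident c) (Ident a \<otimes>\<^sub>t Ident (m + c))"
    unfolding c by (intro eq_Tensor eq_refl arr_Ident tensor_Ident)
  also have "mor_eq R n n \<dots> (Ident n)"
    unfolding c by (rule tensor_Ident)
  finally show ?thesis by (simp add: pad_def c)
qed

lemma pad_tensor_Ident:
  assumes "arr f m m" "a + (m + p) \<le> n"
  shows "mor_eq R n n (pad n a (f \<otimes>\<^sub>t Ident p)) (pad n a f)"
proof -
  from assms obtain c where c: "n = a + (m + p + c)" by (metis le_Suc_ex add.assoc)
  have "mor_eq R n n (Ident a \<otimes>\<^sub>t (f \<otimes>\<^sub>t Ident p) \<otimes>\<^sub>t Ident c)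
    (Ident a \<otimes>\<^sub>t f \<otimes>\<^sub>t Ident p \<otimes>\<^sub>t Ident c)"
    unfolding c by (intro eq_Tensor eq_refl arr_Ident tensor_assoc assms)
  also have "mor_eq R n n \<dots> (Ident a \<otimes>\<^sub>t f \<otimes>\<^sub>t Ident (p + c))"
    unfolding c add.assoc by (intro eq_Tensor eq_refl arr_Ident tensor_Ident assms)
  finally show ?thesis
    using arr_width[OF assms(1)] by (simp add: pad_def c)
qed

lemma pad_Ident_tensor:
  assumes "arr g p p" "a + (m + p) \<le> n"
  shows "mor_eq R n n (pad n a (Ident m \<otimes>\<^sub>t g)) (pad n (a + m) g)"
proof -
  from assms obtain c where c: "n = a + (m + p + c)" by (metis le_Suc_ex add.assoc)
  have "mor_eq R n n (Ident a \<otimes>\<^sub>t (Ident m \<otimes>\<^sub>t g) \<otimes>\<^sub>t Ident c)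
    (Ident a \<otimes>\<^sub>t Ident m \<otimes>\<^sub>t g \<otimes>\<^sub>t Ident c)"
    unfolding c by (intro eq_Tensor eq_refl arr_Ident tensor_assoc assms)
  also have "mor_eq R n n \<dots> ((Ident a \<otimes>\<^sub>t Ident m) \<otimes>\<^sub>t g \<otimes>\<^sub>t Ident c)"
  proof -
    have "arr (g \<otimes>\<^sub>t Ident c) (p + c) (p + c)"
      by (intro arr_Tensor arr_Ident assms)
    from tensor_assoc[OF arr_Ident arr_Ident this, of R a m]
    show ?thesis by (simp add: c add.assoc eq_sym)
  qed
  also have "mor_eq R n n \<dots> (Ident (a + m) \<otimes>\<^sub>t g \<otimes>\<^sub>t Ident c)"
  proof -
    have "mor_eq R (a + m + (p + c)) (a + m + (p + c))
      ((Ident a \<otimes>\<^sub>t Ident m) \<otimes>\<^sub>t g \<otimes>\<^sub>t Ident c) (Ident (a + m) \<otimes>\<^sub>t g \<otimes>\<^sub>t Ident c)"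
      by (intro eq_Tensor tensor_Ident eq_refl arr_Tensor arr_Ident assms)
    then show ?thesis by (simp add: c add.assoc)
  qed
  finally show ?thesis
    using arr_width[OF assms(1)] by (simp add: pad_def c)
qed

section \<open>Padded terms in the group of endomorphisms\<close>

definition pad_class :: "nat \<Rightarrow> nat \<Rightarrow> sc_term \<Rightarrow> sc_term set" where
  "pad_class n a f = mor_class SC_rel n n (pad n a f)"

lemma mor_class_eqI: "mor_eq R m n f g \<Longrightarrow> mor_class R m n f = mor_class R m n g"
  by (metis mor_class_eq_iff mor_eq_arr)

lemma SC_end_class_closed: "arr f n n \<Longrightarrow> mor_class SC_rel n n f \<in> carrier (SC_end n)"
  by (auto simp: SC_end_def end_monoid_def hom_set_def)

lemma pad_class_closed:
  "arr f m m \<Longrightarrow> a + m \<le> n \<Longrightarrow> pad_class n a f \<in> carrier (SC_end n)"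
  unfolding pad_class_def by (intro SC_end_class_closed arr_pad)

lemma pad_class_cong:
  "mor_eq SC_rel m m f g \<Longrightarrow> a + m \<le> n \<Longrightarrow> pad_class n a f = pad_class n a g"
  unfolding pad_class_def by (intro mor_class_eqI pad_cong)

lemma pad_class_rel:
  "SC_rel m f g \<Longrightarrow> a + m \<le> n \<Longrightarrow> pad_class n a f = pad_class n a g"
  by (rule pad_class_cong[OF eq_rel]) (auto dest: SC_rel_arr)

lemma pad_class_Comp:
  assumes "arr f m m" "arr g m m" "a + m \<le> n"
  shows "pad_class n a (g \<cdot> f) = pad_class n a g \<otimes>\<^bsub>SC_end n\<^esub> pad_class n a f"
  unfolding pad_class_def SC_end_def using assms
  by (simp add: end_monoid_mult_class[OF arr_pad arr_pad] mor_class_eqI[OF pad_Comp])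

lemma pad_class_Ident:
  assumes "a + m \<le> n"
  shows "pad_class n a (Ident m) = \<one>\<^bsub>SC_end n\<^esub>"
  unfolding pad_class_def SC_end_def
  by (simp add: end_monoid_def mor_class_eqI[OF pad_Ident[OF assms]])

lemma pad_class_shift:
  assumes "arr g p p" "a + (m + p) \<le> n"
  shows "pad_class n a (Ident m \<otimes>\<^sub>t g) = pad_class n (a + m) g"
  unfolding pad_class_def by (rule mor_class_eqI[OF pad_Ident_tensor[OF assms]])

lemma pad_class_tensor_Ident:
  assumes "arr f m m" "a + (m + p) \<le> n"
  shows "pad_class n a (f \<otimes>\<^sub>t Ident p) = pad_class n a f"
  unfolding pad_class_def by (rule mor_class_eqI[OF pad_tensor_Ident[OF assms]])

lemma pad_class_tensor:
  assumes "arr f m m" "arr g p p" "a + (m + p) \<le> n"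
  shows "pad_class n a (f \<otimes>\<^sub>t g) = pad_class n a f \<otimes>\<^bsub>SC_end n\<^esub> pad_class n (a + m) g"
    and "pad_class n a (f \<otimes>\<^sub>t g) = pad_class n (a + m) g \<otimes>\<^bsub>SC_end n\<^esub> pad_class n a f"
proof -
  have arr: "arr (f \<otimes>\<^sub>t Ident p) (m + p) (m + p)" "arr (Ident m \<otimes>\<^sub>t g) (m + p) (m + p)"
    using assms by (auto intro: arr_Tensor arr_Ident)
  show "pad_class n a (f \<otimes>\<^sub>t g) = pad_class n a f \<otimes>\<^bsub>SC_end n\<^esub> pad_class n (a + m) g"
    using pad_class_cong[OF tensor_eq_Comp(1)[OF assms(1,2)] assms(3)] assms arr
    by (simp add: pad_class_Comp pad_class_shift pad_class_tensor_Ident)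
  show "pad_class n a (f \<otimes>\<^sub>t g) = pad_class n (a + m) g \<otimes>\<^bsub>SC_end n\<^esub> pad_class n a f"
    using pad_class_cong[OF tensor_eq_Comp(2)[OF assms(1,2)] assms(3)] assms arr
    by (simp add: pad_class_Comp pad_class_shift pad_class_tensor_Ident)
qed

text \<open>The gap between the blocks is filled with \<open>d\<close> identity strands, attached to
  \<open>g\<close>. Then \<open>f\<close> and \<open>Ident d \<otimes>\<^sub>t g\<close> are
  adjacent, and their tensor product factors in either order.\<close>

lemma pad_class_commute:
  assumes "arr f m m" "arr g p p" "a + m \<le> b" "b + p \<le> n"
  shows "pad_class n a f \<otimes>\<^bsub>SC_end n\<^esub> pad_class n b g =
    pad_class n b g \<otimes>\<^bsub>SC_end n\<^esub> pad_class n a f"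
proof -
  from assms(3) obtain d where b: "b = a + m + d" by (metis le_Suc_ex)
  have "arr (Ident d \<otimes>\<^sub>t g) (d + p) (d + p)" using assms by (intro arr_Tensor arr_Ident)
  from pad_class_tensor[OF assms(1) this, of a n] show ?thesis
    using assms b pad_class_shift[OF assms(2), of "a + m" d n] by simp
qed

text \<open>The generator \<open>v_i\<close> has \<open>i - 1\<close> factors to its left, whence
  the shift by one.\<close>

lemma pad_class_v_at:
  assumes "1 \<le> i" "i < N" "a + N \<le> n"
  shows "pad_class n a (v_at N i) = pad_class n (a + i - 1) V"
proof -
  have "arr (V \<otimes>\<^sub>t Ident (N - i - 1)) (2 + (N - i - 1)) (2 + (N - i - 1))"
    by (intro arr_Tensor arr_Ident arr_V)
  with assms show ?thesis
    by (simp add: v_at_def pad_class_shift pad_class_tensor_Ident[OF arr_V] del: add_2_eq_Suc)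
qed

lemma pad_class_mu12: "2 \<le> N \<Longrightarrow> a + N \<le> n \<Longrightarrow> pad_class n a (mu12 N) = pad_class n a Mu"
  by (simp add: mu12_def pad_class_tensor_Ident[OF arr_Mu])


section \<open>The two families\<close>

definition SC_v :: "nat \<Rightarrow> nat \<Rightarrow> sc_term set" where
  "SC_v n i = pad_class n (i - 1) V"

definition SC_s :: "nat \<Rightarrow> nat \<Rightarrow> sc_term set" where
  "SC_s n i = pad_class n (i - 1) Mu \<otimes>\<^bsub>SC_end n\<^esub> SC_v n i"

text \<open>The involution, braid, slide and Yang-Baxter relations on two or three strands are
  padded to an arbitrary position; distant elements commute by interchange.\<close>

lemma virtual_braid_family_SC_end: "virtual_braid_family (SC_end n) n (SC_s n) (SC_v n)"
proof -
  interpret group "SC_end n" by (rule group_SC_end)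
  let ?mult = "mult (SC_end n)"
  define m where "m i = pad_class n (i - 1) Mu" for i
  define v where "v i = pad_class n (i - 1) V" for i
  have defs: "SC_s n = (\<lambda>i. ?mult (m i) (v i))" "SC_v n = v"
    by (simp_all add: fun_eq_iff SC_s_def SC_v_def m_def v_def)
  have m [simp]: "m i \<in> carrier (SC_end n)" and v [simp]: "v i \<in> carrier (SC_end n)"
    if "1 \<le> i" "i < n" for i
    using that by (auto simp: m_def v_def intro!: pad_class_closed arr_Mu arr_V)
  have far: "?mult (m i) (m j) = ?mult (m j) (m i)" "?mult (m i) (v j) = ?mult (v j) (m i)"
    "?mult (v i) (m j) = ?mult (m j) (v i)" "?mult (v i) (v j) = ?mult (v j) (v i)"
    if "1 \<le> i" "Suc i < j" "j < n" for i j
    unfolding m_def v_def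
    by (rule pad_class_commute[where m = 2 and p = 2]; use that in \<open>simp add: arr_Mu arr_V\<close>)+
  have sq: "?mult (v i) (v i) = \<one>\<^bsub>SC_end n\<^esub>" if "1 \<le> i" "i < n" for i
    using pad_class_rel[of 2 "V \<cdot> V" "Ident 2" "i - 1" n] that
    by (simp add: SC_rel_def v_v pad_class_Comp[where m = 2] arr_V pad_class_Ident v_def)
  have eqs: "?mult (v i) (?mult (v (Suc i)) (v i)) = ?mult (v (Suc i)) (?mult (v i) (v (Suc i)))"
    "m (Suc i) = ?mult (v i) (?mult (v (Suc i)) (?mult (m i) (?mult (v (Suc i)) (v i))))"
    "?mult (m i) (?mult (v (Suc i)) (?mult (m i) (?mult (v (Suc i)) (?mult (v i)
      (?mult (v (Suc i)) (?mult (m i) (?mult (v (Suc i)) (v i)))))))) =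
     ?mult (v i) (?mult (v (Suc i)) (?mult (m i) (?mult (v (Suc i)) (?mult (v i)
      (?mult (v (Suc i)) (?mult (m i) (?mult (v (Suc i)) (m i))))))))"
    if "1 \<le> i" "Suc i < n" for i
  proof -
    \<comment> \<open>The factors \<open>i\<close>, \<open>i + 1\<close>, \<open>i + 2\<close> form
      the block of width 3 at offset \<open>a\<close>, so the local indices 1 and 2 become
      \<open>i\<close> and \<open>Suc i\<close>.\<close>
    from \<open>1 \<le> i\<close> obtain a where a: "i = Suc a" by (cases i) auto
    let ?P = "pad_class n a"
    have arr: "arr (v_at 3 1) 3 3" "arr (v_at 3 2) 3 3" "arr (mu12 3) 3 3"
      by (simp_all add: arr_v arr_mu12)
    have P: "?P (v_at 3 1) = v i" "?P (v_at 3 2) = v (Suc i)" "?P (mu12 3) = m i"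
      using that a pad_class_v_at[of 1 3 a n] pad_class_v_at[of 2 3 a n] pad_class_mu12[of 3 a n]
      by (simp_all add: v_def m_def)
    have comp: "?P (g \<cdot> f) = ?mult (?P g) (?P f)" if "arr f 3 3" "arr g 3 3" for f g
      using pad_class_Comp[OF that] \<open>Suc i < n\<close> a by simp
    have rel: "SC_rel 3 f g \<Longrightarrow> ?P f = ?P g" for f g
      using pad_class_rel[of 3 f g] that a by simp
    note [simp] = comp arr arr_Comp[of _ 3 3 _ 3] P and [simp del] = One_nat_def
    show "?mult (v i) (?mult (v (Suc i)) (v i)) = ?mult (v (Suc i)) (?mult (v i) (v (Suc i)))"
      using rel[OF SC_rel_def[THEN iffD2, OF disjI1, OF v_braid[of 1 3, unfolded one_add_one]]]
      by simp
    have "?P (Ident 1 \<otimes>\<^sub>t Mu) = m (Suc i)"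
      using that pad_class_shift[OF arr_Mu, of a 1 n] by (simp add: m_def a Suc_eq_plus1)
    with rel[OF SC_rel_def[THEN iffD2, OF disjI2, OF slide]] show
      "m (Suc i) = ?mult (v i) (?mult (v (Suc i)) (?mult (m i) (?mult (v (Suc i)) (v i))))"
      by simp
    show "?mult (m i) (?mult (v (Suc i)) (?mult (m i) (?mult (v (Suc i)) (?mult (v i)
        (?mult (v (Suc i)) (?mult (m i) (?mult (v (Suc i)) (v i)))))))) =
      ?mult (v i) (?mult (v (Suc i)) (?mult (m i) (?mult (v (Suc i)) (?mult (v i)
        (?mult (v (Suc i)) (?mult (m i) (?mult (v (Suc i)) (m i))))))))"
      using rel[OF SC_rel_def[THEN iffD2, OF disjI1, OF yang_baxter]]
      by simp
  qed
  have braid: "?mult (v (Suc i)) (?mult (v i) (?mult (v (Suc i)) x)) =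
      ?mult (v i) (?mult (v (Suc i)) (?mult (v i) x))"
    if "1 \<le> i" "Suc i < n" "x \<in> carrier (SC_end n)" for i x
    using arg_cong[OF eqs(1)[of i], of "\<lambda>y. ?mult y x"] that by (simp add: m_assoc)
  show ?thesis
    unfolding defs
  proof
    fix i assume i: "1 \<le> i" "Suc i < n"
    show "?mult (?mult (m i) (v i)) (?mult (?mult (m (Suc i)) (v (Suc i))) (?mult (m i) (v i))) =
      ?mult (?mult (m (Suc i)) (v (Suc i))) (?mult (?mult (m i) (v i)) (?mult (m (Suc i)) (v (Suc i))))"
      using i
      \<comment> \<open>The slide relation \<open>eqs(2)\<close> presents \<open>m (Suc i)\<close>
        as the \<open>c\<close> of the criterion, and \<open>eqs(3)\<close> is the Yang-Baxter
        equation.\<close>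
      by (intro yang_baxter_iff_braid[THEN iffD2, OF v v m sq sq eqs(1)[symmetric] eqs(2) eqs(3)]) auto
    show "?mult (v i) (?mult (?mult (m (Suc i)) (v (Suc i))) (v i)) =
      ?mult (v (Suc i)) (?mult (?mult (m i) (v i)) (v (Suc i)))"
      \<comment> \<open>(M1): after the slide relation is inserted, the leading \<open>v i\<close>
        cancels on the left, and the braid relation shortens the tail to \<open>v i\<close> followed
        by \<open>v (Suc i)\<close>.\<close>
      using i by (simp add: eqs(2) m_assoc braid eqs(1)[symmetric] sq cancel_involution)
  next
    fix i j assume i: "1 \<le> i" "Suc i < j" "j < n"
    show 1: "?mult (?mult (m i) (v i)) (v j) = ?mult (v j) (?mult (m i) (v i))"
      using i far[of i j] by (intro commute_mult[symmetric]) auto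
    have 2: "?mult (?mult (m i) (v i)) (m j) = ?mult (m j) (?mult (m i) (v i))"
      using i far[of i j] by (intro commute_mult[symmetric]) auto
    show "?mult (?mult (m i) (v i)) (?mult (m j) (v j)) =
      ?mult (?mult (m j) (v j)) (?mult (m i) (v i))"
      using i 1 2 by (intro commute_mult) auto
    show "?mult (v i) (?mult (m j) (v j)) = ?mult (?mult (m j) (v j)) (v i)"
      using i far[of i j] by (intro commute_mult) auto
  qed (use far(4) in \<open>simp_all add: sq eqs(1)\<close>)
qed

interpretation SC: virtual_braid_family "SC_end n" n "SC_s n" "SC_v n" for n
  by (rule virtual_braid_family_SC_end)

lemma SC_s_v:
  assumes "Suc k < n"
  shows "SC_s n (Suc k) \<otimes>\<^bsub>SC_end n\<^esub> SC_v n (Suc k) = pad_class n k Mu"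
proof -
  have "pad_class n k Mu \<in> carrier (SC_end n)"
    using assms by (intro pad_class_closed[OF arr_Mu]) simp
  with assms show ?thesis
    using SC.v_v[of "Suc k" n] SC.v_closed[of "Suc k" n] by (simp add: SC_s_def SC.m_assoc)
qed

text \<open>The recursion of \<open>sc_eval\<close> mirrors the behaviour of padding under
  composition and tensor product. On the generator \<open>Mu\<close> the value is
  \<open>\<mu> v v\<close>, which is \<open>\<mu>\<close> again. At offset 0 and full width a term
  thus evaluates to its own class.\<close>

lemma SC_sc_eval:
  assumes "arr f m m'" "k + m \<le> n"
  shows "SC.sc_eval n k f = pad_class n k f"
  using assms
proof (induction arbitrary: k rule: arr.induct)
  case (arr_Ident m)
  then show ?case by (simp add: pad_class_Ident)
next
  case arr_Mu
  then show ?case by (simp add: SC_s_v)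
next
  case arr_Mu'
  have closed: "pad_class n k Mu \<in> carrier (SC_end n)" "pad_class n k Mu' \<in> carrier (SC_end n)"
    using arr_Mu' by (auto intro!: pad_class_closed arr.arr_Mu arr.arr_Mu')
  have "pad_class n k Mu' \<otimes>\<^bsub>SC_end n\<^esub> pad_class n k Mu = \<one>\<^bsub>SC_end n\<^esub>"
    using pad_class_rel[of 2 "Mu' \<cdot> Mu" "Ident 2" k n] arr_Mu'
    by (simp add: SC_rel_def mu'_mu pad_class_Comp[where m = 2] arr.arr_Mu arr.arr_Mu' pad_class_Ident)
  with arr_Mu' closed show ?case by (simp add: SC_s_v SC.inv_equality)
next
  case arr_V
  then show ?case by (simp add: SC_v_def[of n "Suc k"])
next
  case (arr_Comp f k' m g m')
  then have "k' = m" "m' = m" by (auto dest: arr_endo)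
  with arr_Comp show ?case by (simp add: pad_class_Comp)
next
  case (arr_Tensor f m m' g p p')
  then have "width f = m" "m' = m" "p' = p" by (auto dest: arr_endo arr_width)
  with arr_Tensor show ?case by (simp add: pad_class_tensor(1))
qed

lemma pad_class_0:
  assumes "arr f n n"
  shows "pad_class n 0 f = mor_class SC_rel n n f"
proof -
  have "mor_eq SC_rel n n (Ident 0 \<otimes>\<^sub>t f \<otimes>\<^sub>t Ident 0) (f \<otimes>\<^sub>t Ident 0)"
    using arr_Tensor[OF assms arr_Ident[of 0]] by (intro tensor_unit_left) simp
  also have "mor_eq SC_rel n n \<dots> f" by (rule tensor_unit_right[OF assms])
  finally show ?thesis
    unfolding pad_class_def using arr_width[OF assms] by (simp add: pad_def mor_class_eqI)
qed

section \<open>The family in the virtual braid group\<close>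

abbreviation vb_class :: "nat \<Rightarrow> vb_gen word \<Rightarrow> vb_gen word set" where
  "vb_class n u \<equiv> pres_cong (vb_gens n) (vb_rels n) `` {u}"

lemma vb_class_mult:
  "u \<in> words (vb_gens n) \<Longrightarrow> w \<in> words (vb_gens n) \<Longrightarrow>
    vb_class n u \<otimes>\<^bsub>virtual_braid_group n\<^esub> vb_class n w = vb_class n (u @ w)"
  unfolding virtual_braid_group_def by (rule presented_mult_class)

lemma vb_class_one: "\<one>\<^bsub>virtual_braid_group n\<^esub> = vb_class n []"
  by (simp add: virtual_braid_group_def presented_group_def)

lemma carrier_virtual_braid_group: "carrier (virtual_braid_group n) = vb_class n ` words (vb_gens n)"
  by (auto simp: virtual_braid_group_def presented_group_def quotient_def)

lemma vb_class_rel: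
  "(u, w) \<in> vb_rels n \<Longrightarrow> u \<in> words (vb_gens n) \<Longrightarrow> w \<in> words (vb_gens n) \<Longrightarrow>
    vb_class n u = vb_class n w"
  by (intro equiv_class_eq[OF equiv_pres_cong] pres_rel)

lemma vb_gens_iff [simp]:
  "Sigma_gen i \<in> vb_gens n \<longleftrightarrow> 1 \<le> i \<and> i < n" "V_gen i \<in> vb_gens n \<longleftrightarrow> 1 \<le> i \<and> i < n"
  by (auto simp: vb_gens_def)

lemma virtual_braid_family_virtual_braid_group:
  "virtual_braid_family (virtual_braid_group n) n (\<lambda>i. vb_class n [sg i]) (\<lambda>i. vb_class n [vg i])"
proof -
  interpret group "virtual_braid_group n" by (rule group_virtual_braid_group)
  show ?thesis
  proof
    fix i assume "1 \<le> i" "i < n"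
    then show "vb_class n [sg i] \<in> carrier (virtual_braid_group n)"
      "vb_class n [vg i] \<in> carrier (virtual_braid_group n)"
      by (auto simp: carrier_virtual_braid_group)
    show "vb_class n [vg i] \<otimes>\<^bsub>virtual_braid_group n\<^esub> vb_class n [vg i] =
      \<one>\<^bsub>virtual_braid_group n\<^esub>"
      using \<open>1 \<le> i\<close> \<open>i < n\<close> vb_class_rel[OF vb_rels.S3[of i n]]
      by (simp add: vb_class_mult vb_class_one)
  qed (use vb_class_rel[OF vb_rels.B1] vb_class_rel[OF vb_rels.B2] vb_class_rel[OF vb_rels.S1]
      vb_class_rel[OF vb_rels.S2] vb_class_rel[OF vb_rels.M1] vb_class_rel[OF vb_rels.M2]
      vb_class_rel[OF vb_rels.M2, symmetric] in \<open>simp_all add: vb_class_mult\<close>)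
qed

interpretation VB: virtual_braid_family
  "virtual_braid_group n" n "\<lambda>i. vb_class n [sg i]" "\<lambda>i. vb_class n [vg i]" for n
  by (rule virtual_braid_family_virtual_braid_group)

text \<open>The counterpart of \<open>SC_sc_eval\<close> for words. The negative letters need the
  fact that the class of a formal inverse is the inverse of the class.\<close>

lemma VB_word_eval:
  assumes "u \<in> words (vb_gens n)"
  shows "word_eval (virtual_braid_group n) (VB.gen n) u = vb_class n u"
  using assms
proof (induction u)
  case Nil
  then show ?case by (simp add: vb_class_one)
next
  case (Cons x u)
  obtain g b where x: "x = (g, b)" by (cases x)
  with Cons have g: "g \<in> vb_gens n" by simp
  have gen: "VB.gen n g = vb_class n [(g, True)]"
    by (simp add: VB.gen_def split: vb_gen.split)
  have "vb_class n [(g, False), (g, True)] = vb_class n []"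
    using g pres_cancel[of g _ False] by (intro equiv_class_eq[OF equiv_pres_cong]) auto
  then have "inv\<^bsub>virtual_braid_group n\<^esub> vb_class n [(g, True)] = vb_class n [(g, False)]"
    using g by (intro VB.inv_equality) (auto simp: vb_class_mult vb_class_one carrier_virtual_braid_group)
  with gen Cons x g show ?case by (cases b) (auto simp: vb_class_mult)
qed


section \<open>The isomorphism\<close>

text \<open>By \<open>sc_eval_cong\<close> evaluation is constant on each class of terms, so it
  descends to morphisms, and it turns composition into multiplication by definition.\<close>

lemma SC_end_hom:
  obtains h where "h \<in> hom (SC_end n) (virtual_braid_group n)"
    "\<And>f. arr f n n \<Longrightarrow> h (mor_class SC_rel n n f) = VB.sc_eval n 0 f"
proof
  let ?h = "\<lambda>F. the_elem (VB.sc_eval n 0 ` F)"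
  show eval: "?h (mor_class SC_rel n n f) = VB.sc_eval n 0 f" if "arr f n n" for f
  proof -
    have "VB.sc_eval n 0 g = VB.sc_eval n 0 f" if "mor_eq SC_rel n n f g" for g
      using VB.sc_eval_cong[OF that] by simp
    moreover have "f \<in> mor_class SC_rel n n f" using that by (simp add: mor_class_def eq_refl)
    ultimately have "VB.sc_eval n 0 ` mor_class SC_rel n n f = {VB.sc_eval n 0 f}"
      unfolding mor_class_def by blast
    then show ?thesis by simp
  qed
  show "?h \<in> hom (SC_end n) (virtual_braid_group n)"
  proof (rule homI)
    fix G F assume "G \<in> carrier (SC_end n)" "F \<in> carrier (SC_end n)"
    then obtain g f where g: "arr g n n" "G = mor_class SC_rel n n g"
      and f: "arr f n n" "F = mor_class SC_rel n n f"
      by (auto simp: SC_end_def end_monoid_def hom_set_def)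
    then show "?h G \<in> carrier (virtual_braid_group n)" by (auto simp: eval)
    show "?h (G \<otimes>\<^bsub>SC_end n\<^esub> F) = ?h G \<otimes>\<^bsub>virtual_braid_group n\<^esub> ?h F"
      using g f by (simp add: SC_end_def end_monoid_mult_class eval arr_Comp)
  qed
qed

theorem theorem3:
  fixes n :: nat
  assumes "1 \<le> n"
  shows "virtual_braid_group n \<cong> SC_end n"
proof -
  obtain \<phi> where \<phi>: "\<phi> \<in> hom (virtual_braid_group n) (SC_end n)"
    and \<phi>_word: "\<And>u. u \<in> words (vb_gens n) \<Longrightarrow>
      \<phi> (vb_class n u) = word_eval (SC_end n) (SC.gen n) u"
    using SC.virtual_braid_group_hom[of n] by blast
  obtain \<psi> where \<psi>: "\<psi> \<in> hom (SC_end n) (virtual_braid_group n)"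
    and \<psi>_eval: "\<And>f. arr f n n \<Longrightarrow> \<psi> (mor_class SC_rel n n f) = VB.sc_eval n 0 f"
    using SC_end_hom[of n] by blast
  \<comment> \<open>By naturality \<open>\<phi>\<close> carries evaluation in the virtual braid
    group to evaluation in the string category, where a term gives its own class.\<close>
  have \<phi>_\<psi>: "\<phi> (\<psi> F) = F" if "F \<in> carrier (SC_end n)" for F
  proof -
    from that obtain f where f: "arr f n n" "F = mor_class SC_rel n n f"
      by (auto simp: SC_end_def end_monoid_def hom_set_def)
    have "\<phi> (VB.sc_eval n 0 f) = SC.sc_eval n 0 f"
      using f by (intro VB.hom_sc_eval[OF virtual_braid_family_SC_end \<phi>]) (auto simp: \<phi>_word)
    with f show ?thesis by (simp add: \<psi>_eval SC_sc_eval pad_class_0)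
  qed
  have \<psi>_v: "\<psi> (SC_v n i) = vb_class n [vg i]"
    and \<psi>_s: "\<psi> (SC_s n i) = vb_class n [sg i]" if "1 \<le> i" "i < n" for i
  proof -
    have closed: "pad_class n (i - 1) Mu \<in> carrier (SC_end n)"
      "pad_class n (i - 1) V \<in> carrier (SC_end n)"
      using that by (auto intro!: pad_class_closed arr_Mu arr_V)
    \<comment> \<open>The padding identities evaluate to the unit; the left one only moves the
      offset from 0 to \<open>i - 1\<close>.\<close>
    have pad: "\<psi> (pad_class n (i - 1) f) = VB.sc_eval n (i - 1) f" if "arr f 2 2" for f
      unfolding pad_class_def using arr_pad[OF that, of "i - 1" n] \<open>1 \<le> i\<close> \<open>i < n\<close> that
      by (simp add: \<psi>_eval) (simp add: pad_def)
    show v: "\<psi> (SC_v n i) = vb_class n [vg i]"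
      using that pad[OF arr_V] by (simp add: SC_v_def)
    show "\<psi> (SC_s n i) = vb_class n [sg i]"
      \<comment> \<open>Both families use the same convention: \<open>\<psi>\<close> sends
        \<open>\<mu>_i\<close> to \<open>\<sigma>_i v_i\<close>, hence \<open>\<mu>_i v_i\<close> to
        \<open>\<sigma>_i v_i v_i\<close>, which is \<open>\<sigma>_i\<close>.\<close>
      using that closed v hom_mult[OF \<psi> closed] pad[OF arr_Mu] pad[OF arr_V]
      by (simp add: SC_s_def SC_v_def VB.m_assoc VB.v_v)
  qed
  \<comment> \<open>Since \<open>\<psi>\<close> matches the generators, it carries evaluation of
    words in the string category to evaluation in the virtual braid group, where a word gives its
    own class.\<close>
  have \<psi>_\<phi>: "\<psi> (\<phi> A) = A" if "A \<in> carrier (virtual_braid_group n)" for A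
  proof -
    from that obtain u where u: "u \<in> words (vb_gens n)" "A = vb_class n u"
      by (auto simp: carrier_virtual_braid_group)
    have "\<psi> (SC.gen n x) = VB.gen n x" if "x \<in> vb_gens n" for x
      using that by (cases x) (auto simp: \<psi>_s \<psi>_v)
    then have "\<psi> (word_eval (SC_end n) (SC.gen n) u) = word_eval (virtual_braid_group n) (VB.gen n) u"
      by (rule SC.hom_word_eval[OF VB.is_group \<psi> SC.gen_closed _ u(1)])
    with u show ?thesis by (simp add: \<phi>_word VB_word_eval)
  qed
  have "bij_betw \<phi> (carrier (virtual_braid_group n)) (carrier (SC_end n))"
    using \<phi> \<psi> \<phi>_\<psi> \<psi>_\<phi> by (intro bij_betw_byWitness[where f' = \<psi>]) (auto simp: hom_def)
  with \<phi> have "\<phi> \<in> iso (virtual_braid_group n) (SC_end n)" by (simp add: iso_def)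
  then show ?thesis by (auto simp: is_iso_def)
qed

end
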